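(* Let $g,m$ be positive integers with $g\ne1$, and put $h=2\left(\frac{m/g-1}{g-1}+1\right)$. Then $h>0$ and $\frac12\bigl(g^2(h-2)-g(h-4)\bigr)=m$, so that $m=P^h_g$ whenever $h$ is an integer (then $h\ge1$). This happens in the following cases: (i) (trivial cases) $m=g\ge2$ if and only if $h=2$; and for $m\ge1$: $g=2$ if and only if $h=m$. (ii) If $m>g\ge2$, $g\mid m$ and $g-1\mid m-1$, then $h$ is an even integer with $h\ge4$. Moreover, $h$ is an even integer in the following derived cases: (iii) If $g\mid m$ and $s_g(m)=g$, then $h\ge6$. (iv) If $m\in\mathcal S$ and $g$ is a factor of a strict $s$-decomposition of $m$, then $h\ge6$. (v) If $m$ is a Carmichael number and $g$ is a prime divisor of $m$, then $h\ge6$. (vi) Let $n\ge3$ and let $U_n(t)=\prod_{\nu=1}^n g_\nu$ with $g_\nu=a_\nu t+b_\nu$ be a universal form. For a fixed $\nu$ and integer $t\ge0$, if $m=U_n(t)$ and $g=g_\nu$ satisfy $m>g>1$, then $h\ge4$.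
   Context: For integers $h\ge1$ and $n\ge1$, $P^h_n=\frac12\bigl(n^2(h-2)-n(h-4)\bigr)$ is the $h$-gonal number. For an integer base $g\ge2$ and $m\ge0$, $s_g(m)$ is the sum of base-$g$ digits of $m$. A strict $s$-decomposition of a positive integer $m$ is a factorization $m=\prod_{\nu=1}^n g_\nu^{e_\nu}$, $e_\nu\ge1$, with proper factors $1<g_\nu<m$, $g_1<\dots<g_n$ (not necessarily coprime), and $s_{g_\nu}(m)=g_\nu$ for all $\nu$; $\mathcal S$ is the set of positive integers admitting one. A Carmichael number is a composite positive $m$ with $a^{m-1}\equiv1\pmod m$ for all $a$ coprime to $m$. A universal form is a squarefree polynomial $U_n(t)=\prod_{\nu=1}^n(a_\nu t+b_\nu)\in\mathbb Z[t]$ ($n\ge3$) with positive integer coefficients $a_\nu,b_\nu$ such that $U_n(t)\equiv1\pmod{a_\nu t+b_\nu-1}$ for all $1\le\nu\le n$ and all integers $t\ge0$, except for the cases $t=0$ and $b_\nu=1$. *)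

theory Defs
  imports Complex_Main
    "HOL-Number_Theory.Cong"
    "HOL-Computational_Algebra.Polynomial"
    "HOL-Computational_Algebra.Squarefree"
begin

definition polygonal_number :: "int \<Rightarrow> nat \<Rightarrow> real" where
  "polygonal_number h n =
     1 / 2 * (real n ^ 2 * (of_int h - 2) - real n * (of_int h - 4))"

text \<open>
  The \<open>i\<close>-th base-\<open>g\<close> digit of \<open>m\<close> is \<open>m div g ^ i mod g\<close>. For \<open>g \<ge> 2\<close> we have \<open>m < g ^ m\<close>,
  so all digits with index at least \<open>m\<close> vanish and the bound \<open>i < m\<close> loses nothing.
\<close>

definition digit_sum :: "nat \<Rightarrow> nat \<Rightarrow> nat" where
  "digit_sum g m = (\<Sum>i<m. m div g ^ i mod g)"

lemma digit_sum_eq: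
  assumes g: "g \<ge> 2" and N: "m < g ^ N"
  shows "digit_sum g m = (\<Sum>i<N. m div g ^ i mod g)"
proof -
  have zero: "m div g ^ i mod g = 0" if "K \<le> i" "m < g ^ K" for i K
  proof -
    have "g ^ K \<le> g ^ i" using that(1) g by (intro power_increasing) auto
    then show ?thesis using that(2) by simp
  qed
  have mm: "m < g ^ m" using g power_gt_expt[of g m] by simp
  have "(\<Sum>i<m. m div g ^ i mod g) = (\<Sum>i<max m N. m div g ^ i mod g)"
    by (rule sum.mono_neutral_left) (auto intro: zero[OF _ mm])
  moreover have "(\<Sum>i<N. m div g ^ i mod g) = (\<Sum>i<max m N. m div g ^ i mod g)"
    by (rule sum.mono_neutral_left) (auto intro: zero[OF _ N])
  ultimately show ?thesis by (simp add: digit_sum_def)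
qed

definition strict_s_decomposition ::
  "nat \<Rightarrow> nat \<Rightarrow> (nat \<Rightarrow> nat) \<Rightarrow> (nat \<Rightarrow> nat) \<Rightarrow> bool" where
  "strict_s_decomposition m n \<gamma> e \<longleftrightarrow>
     n \<ge> 1 \<and>
     m = (\<Prod>\<nu>=1..n. \<gamma> \<nu> ^ e \<nu>) \<and>
     strict_mono_on {1..n} \<gamma> \<and>
     (\<forall>\<nu>\<in>{1..n}. e \<nu> \<ge> 1 \<and> 1 < \<gamma> \<nu> \<and> \<gamma> \<nu> < m \<and> digit_sum (\<gamma> \<nu>) m = \<gamma> \<nu>)"

definition strict_s_decomposable :: "nat set" where
  "strict_s_decomposable = {m. m > 0 \<and> (\<exists>n \<gamma> e. strict_s_decomposition m n \<gamma> e)}"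

definition carmichael_number :: "nat \<Rightarrow> bool" where
  "carmichael_number m \<longleftrightarrow>
     m > 1 \<and> \<not> prime m \<and> (\<forall>a::int. coprime a (int m) \<longrightarrow> [a ^ (m - 1) = 1] (mod int m))"

definition linear_product :: "nat \<Rightarrow> (nat \<Rightarrow> int) \<Rightarrow> (nat \<Rightarrow> int) \<Rightarrow> int poly" where
  "linear_product n a b = (\<Prod>\<nu>=1..n. [:b \<nu>, a \<nu>:])"

text \<open>
  A squarefree polynomial is one without repeated factors of positive degree. Applying
  \<^const>\<open>squarefree\<close> in the ring of integer polynomials would in addition force the content to
  be squarefree, which would exclude forms such as \<open>(30t+28)(90t+82)(150t+136)\<close>, so it
  is applied after passing to rational coefficients, where nonzero constants are units.
\<close>

definition universal_form :: "nat \<Rightarrow> (nat \<Rightarrow> int) \<Rightarrow> (nat \<Rightarrow> int) \<Rightarrow> bool" where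
  "universal_form n a b \<longleftrightarrow>
     n \<ge> 3 \<and>
     (\<forall>\<nu>\<in>{1..n}. a \<nu> > 0 \<and> b \<nu> > 0) \<and>
     squarefree (map_poly rat_of_int (linear_product n a b)) \<and>
     (\<forall>\<nu>\<in>{1..n}. \<forall>t\<ge>0. \<not> (t = 0 \<and> b \<nu> = 1) \<longrightarrow>
        [poly (linear_product n a b) t = 1] (mod (a \<nu> * t + b \<nu> - 1)))"

end

theory Submission
  imports Defs "HOL-Number_Theory.Residue_Primitive_Roots"
begin

text \<open>
  Writing \<open>m = g q\<close>, one has \<open>h = 2 ((q - 1) / (g - 1) + 1)\<close>, so \<open>h\<close> is an even integer as soon as
  \<open>g - 1\<close> divides \<open>q - 1\<close>, equivalently \<open>m - 1\<close>. Then \<open>q = 1 + j (g - 1)\<close> and \<open>h = 2 (j + 1)\<close>, where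
  \<open>j = 0\<close> and \<open>j = 1\<close> mean \<open>m = g\<close> and \<open>m = g\<^sup>2\<close>. The bound \<open>h \<ge> 6\<close> thus amounts to excluding these
  two values: both have digit sum \<open>1\<close> in base \<open>g\<close>, and neither a prime nor its square is a
  Carmichael number.
\<close>

text \<open>With \<open>m = g * q\<close>, the identity g q - 1 = (g - 1) q + (q - 1) moves the
  divisibility from \<open>m - 1\<close> to \<open>q - 1\<close>.\<close>

lemma quotient_minus_one_multiple:
  fixes g m :: nat
  assumes "g \<ge> 2" "m > 0" "g dvd m" "(g - 1) dvd (m - 1)"
  obtains j where "m = g * (1 + j * (g - 1))"
proof -
  obtain q where q: "m = g * q" using assms(3) by blast
  have "q \<ge> 1" using q assms(2) by (cases q) auto
  have "m - 1 = (g - 1) * q + (q - 1)"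
    using q \<open>q \<ge> 1\<close> assms(1) by (cases g; cases q) auto
  then have "(g - 1) dvd (q - 1)"
    using assms(4) by (metis dvd_add_right_iff dvd_triv_left)
  then obtain j where "q - 1 = (g - 1) * j" by blast
  then have "q = 1 + j * (g - 1)" using \<open>q \<ge> 1\<close> by (simp add: mult.commute)
  with q that show thesis by blast
qed

lemma h_eq:
  fixes g j :: nat
  assumes "g \<ge> 2"
  shows "2 * ((real (g * (1 + j * (g - 1))) / real g - 1) / (real g - 1) + 1) = 2 * (real j + 1)"
proof -
  have "real (g * (1 + j * (g - 1))) = real g * (1 + real j * (real g - 1))"
    using assms by (simp add: of_nat_diff distrib_left)
  then have "real (g * (1 + j * (g - 1))) / real g = 1 + real j * (real g - 1)"
    using assms by (metis nonzero_mult_div_cancel_left of_nat_0_eq_iff not_numeral_le_zero)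
  then show ?thesis using assms by simp
qed

lemma h_even_ge_4:
  fixes g m :: nat and h :: real
  assumes "h = 2 * ((real m / real g - 1) / (real g - 1) + 1)"
    and "g \<ge> 2" "m > g" "g dvd m" "(g - 1) dvd (m - 1)"
  shows "\<exists>k::int. h = of_int k \<and> even k \<and> k \<ge> 4"
proof -
  obtain j where j: "m = g * (1 + j * (g - 1))"
    using quotient_minus_one_multiple[of g m] assms by auto
  have "j \<noteq> 0" using j \<open>m > g\<close> by (intro notI) simp
  moreover have "h = 2 * (real j + 1)" using h_eq[OF \<open>g \<ge> 2\<close>] assms(1) j by simp
  ultimately show ?thesis by (intro exI[of _ "2 * (int j + 1)"]) auto
qed

lemma h_even_ge_6:
  fixes g m :: nat and h :: real
  assumes "h = 2 * ((real m / real g - 1) / (real g - 1) + 1)"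
    and "g \<ge> 2" "m > 0" "m \<noteq> g" "m \<noteq> g\<^sup>2" "g dvd m" "(g - 1) dvd (m - 1)"
  shows "\<exists>k::int. h = of_int k \<and> even k \<and> k \<ge> 6"
proof -
  obtain j where j: "m = g * (1 + j * (g - 1))"
    using quotient_minus_one_multiple[of g m] assms by auto
  have "j \<noteq> 0" using j \<open>m \<noteq> g\<close> by (intro notI) simp
  moreover have "j \<noteq> 1" using j \<open>m \<noteq> g\<^sup>2\<close> \<open>g \<ge> 2\<close> by (intro notI) (simp add: power2_eq_square)
  moreover have "h = 2 * (real j + 1)" using h_eq[OF \<open>g \<ge> 2\<close>] assms(1) j by simp
  ultimately show ?thesis by (intro exI[of _ "2 * (int j + 1)"]) auto
qed

text \<open>Keeping the tail term makes the identity hold for every \<open>N\<close>, so the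
  induction needs no bound; the tail vanishes once \<open>m < g ^ N\<close>.\<close>

lemma digits_expansion:
  fixes g m :: nat
  shows "m = (\<Sum>i<N. (m div g ^ i mod g) * g ^ i) + g ^ N * (m div g ^ N)"
proof (induction N)
  case (Suc N)
  have "m div g ^ N = m div g ^ N mod g + g * (m div g ^ Suc N)"
    by (metis div_mult2_eq mod_mult_div_eq mult.commute power_Suc)
  then have "g ^ N * (m div g ^ N) = (m div g ^ N mod g) * g ^ N + g ^ Suc N * (m div g ^ Suc N)"
    by (metis distrib_left mult.assoc mult.commute power_Suc2)
  with Suc.IH show ?case by simp
qed simp

text \<open>Casting out g - 1: every power of \<open>g\<close> is congruent to 1, so the
  base-\<open>g\<close> expansion collapses to the sum of its digits.\<close>

lemma digit_sum_cong:
  fixes g m :: nat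
  assumes "g \<ge> 2"
  shows "[m = digit_sum g m] (mod (g - 1))"
proof -
  have "m < g ^ m" using assms power_gt_expt[of g m] by simp
  then have m: "m = (\<Sum>i<m. (m div g ^ i mod g) * g ^ i)"
    using digits_expansion[of m g m] by simp
  have "[g = 1] (mod (g - 1))" using assms by (simp add: cong_altdef_nat)
  then have "[(\<Sum>i<m. (m div g ^ i mod g) * g ^ i) = (\<Sum>i<m. (m div g ^ i mod g) * 1)] (mod (g - 1))"
    by (intro cong_sum cong_mult cong_refl) (metis cong_pow power_one)
  then show ?thesis using m by (simp add: digit_sum_def)
qed

lemma digit_sum_power:
  fixes g k :: nat
  assumes "g \<ge> 2"
  shows "digit_sum g (g ^ k) = 1"
proof -
  \<comment> \<open>This bound cuts the sum down to the indices 0 to \<open>k\<close>; the only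
    nonzero digit is the 1 at index \<open>k\<close>.\<close>
  have "g ^ k < g ^ Suc k" using assms by simp
  then have "digit_sum g (g ^ k) = (\<Sum>i<Suc k. g ^ k div g ^ i mod g)"
    using digit_sum_eq[OF assms] by blast
  also have "\<dots> = (\<Sum>i<k. g ^ k div g ^ i mod g) + 1"
    using assms by simp
  also have "(\<Sum>i<k. g ^ k div g ^ i mod g) = 0"
  proof (intro sum.neutral ballI)
    fix i assume "i \<in> {..<k}"
    then have "g ^ k div g ^ i = g ^ (k - i)" "k - i > 0"
      using assms by (simp_all add: power_diff)
    then show "g ^ k div g ^ i mod g = 0" by simp
  qed
  finally show ?thesis by simp
qed

lemma h_even_ge_6_digit_sum:
  fixes g m :: nat and h :: real
  assumes "h = 2 * ((real m / real g - 1) / (real g - 1) + 1)"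
    and "g \<ge> 2" "m > 0" "g dvd m" "digit_sum g m = g"
  shows "\<exists>k::int. h = of_int k \<and> even k \<and> k \<ge> 6"
proof (rule h_even_ge_6[OF assms(1-3) _ _ assms(4)])
  show "m \<noteq> g" using digit_sum_power[of g 1] assms by auto
  show "m \<noteq> g\<^sup>2" using digit_sum_power[of g 2] assms by auto
  have "[m = g] (mod (g - 1))" using digit_sum_cong[of g m] assms by simp
  also have "[g = 1] (mod (g - 1))" using assms by (simp add: cong_altdef_nat)
  finally show "(g - 1) dvd (m - 1)" using \<open>m > 0\<close> by (simp add: cong_altdef_nat)
qed

text \<open>Carries the integer congruence over to naturals, where orders and primitive roots
  live.\<close>

lemma carmichael_number_nat:
  assumes "carmichael_number m" "coprime a m"
  shows "[a ^ (m - 1) = 1] (mod m)"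
proof -
  have "[int a ^ (m - 1) = 1] (mod int m)"
    using assms unfolding carmichael_number_def by simp
  then show ?thesis by (metis cong_int_iff of_nat_1 of_nat_power)
qed

text \<open>The base 1 + p is a witness: modulo p^2 its N-th power is 1 + N p, so the Carmichael
  condition would force p to divide m - 1 as well as m.\<close>

lemma carmichael_not_prime_square:
  assumes "carmichael_number m" "prime p"
  shows "m \<noteq> p\<^sup>2"
proof
  assume m: "m = p\<^sup>2"
  have p: "p \<ge> 2" using assms(2) by (rule prime_ge_2_nat)
  have "(1 + p) ^ N mod p\<^sup>2 = (1 + N * p) mod p\<^sup>2" for N
  proof (induction N)
    case (Suc N)
    have "(1 + p) ^ Suc N mod p\<^sup>2 = (1 + p) * (1 + N * p) mod p\<^sup>2"
      using Suc.IH by (metis mod_mult_right_eq power_Suc)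
    also have "(1 + p) * (1 + N * p) = (1 + Suc N * p) + N * p\<^sup>2"
      by (simp add: algebra_simps power2_eq_square)
    finally show ?case by simp
  qed simp
  then have pow: "[(1 + p) ^ (m - 1) = 1 + (m - 1) * p] (mod m)" by (simp add: cong_def m)
  have "coprime (1 + p) m" unfolding m by simp
  then have "[(1 + p) ^ (m - 1) = 1] (mod m)"
    by (rule carmichael_number_nat[OF assms(1)])
  with pow have "[1 + (m - 1) * p = 1] (mod m)" by (metis cong_sym cong_trans)
  then have "p * p dvd (m - 1) * p" by (simp add: cong_altdef_nat m power2_eq_square)
  then have "p dvd m - 1" using p by simp
  moreover have "p dvd m" by (simp add: m power2_eq_square)
  moreover have "m > 0" using m p by simp
  ultimately have "p dvd 1" by (metis Suc_pred' dvd_add_right_iff plus_1_eq_Suc add.commute One_nat_def)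
  then show False using p by simp
qed

text \<open>A primitive root modulo \<open>p\<close> is lifted to a unit modulo \<open>m\<close> by the Chinese remainder theorem.\<close>

lemma carmichael_prime_minus_one_dvd:
  assumes "carmichael_number m" "prime p" "p dvd m"
  shows "(p - 1) dvd (m - 1)"
proof -
  have p: "p > 1" using assms(2) by (rule prime_gt_1_nat)
  have m: "m > 0" using assms(1) by (simp add: carmichael_number_def)
  \<comment> \<open>Splitting off the full power of \<open>p\<close> leaves a cofactor coprime to
    \<open>p\<close>, as the Chinese remainder theorem requires.\<close>
  obtain r where r: "m = p ^ multiplicity p m * r" "\<not> p dvd r"
    using multiplicity_decompose'[of m p] m p by auto
  have "coprime p r" using r(2) assms(2) by (simp add: prime_imp_coprime)
  obtain z where z: "residue_primroot p z"
    using prime_primitive_root_exists[OF p assms(2)] by blast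
  \<comment> \<open>The primitive root \<open>z\<close> may share factors with \<open>r\<close>;
    prescribing 1 modulo \<open>r\<close> removes them without changing the order modulo
    \<open>p\<close>.\<close>
  obtain x where x: "[x = z] (mod p)" "[x = 1] (mod r)"
    using binary_chinese_remainder_nat[OF \<open>coprime p r\<close>] by blast
  have xroot: "ord p x = p - 1" "coprime x p"
    using z x(1) assms(2) ord_cong[of x z p] cong_imp_coprime[of z x p]
    by (auto simp: residue_primroot_def totient_prime coprime_commute cong_sym)
  have "coprime x r" using x(2) by (metis cong_imp_coprime cong_sym coprime_1_left)
  with xroot(2) have "coprime x m" by (subst r(1)) simp
  then have "[x ^ (m - 1) = 1] (mod p)"
    using carmichael_number_nat[OF assms(1)] assms(3) cong_dvd_modulus_nat by blast
  then show ?thesis using xroot(1) by (metis ord_divides)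
qed

lemma poly_linear_product:
  "poly (linear_product n a b) t = (\<Prod>\<nu>=1..n. a \<nu> * t + b \<nu>)"
  by (simp add: linear_product_def poly_prod algebra_simps)

theorem theorem10p3:
  fixes g m :: nat and h :: real
  assumes "g > 0" and "m > 0" and "g \<noteq> 1"
    and "h = 2 * ((real m / real g - 1) / (real g - 1) + 1)"
  shows "h > 0 \<and>
    1 / 2 * (real g ^ 2 * (h - 2) - real g * (h - 4)) = real m \<and>
    (\<forall>k::int. h = of_int k \<longrightarrow> k \<ge> 1 \<and> real m = polygonal_number k g) \<and>
    (m = g \<and> g \<ge> 2 \<longleftrightarrow> h = 2) \<and>
    (g = 2 \<longleftrightarrow> h = real m) \<and>
    (m > g \<and> g \<ge> 2 \<and> g dvd m \<and> (g - 1) dvd (m - 1) \<longrightarrow>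
       (\<exists>k::int. h = of_int k \<and> even k \<and> k \<ge> 4)) \<and>
    (g dvd m \<and> digit_sum g m = g \<longrightarrow>
       (\<exists>k::int. h = of_int k \<and> even k \<and> k \<ge> 6)) \<and>
    (m \<in> strict_s_decomposable \<and>
       (\<exists>n \<gamma> e. strict_s_decomposition m n \<gamma> e \<and> (\<exists>\<nu>\<in>{1..n}. g = \<gamma> \<nu>)) \<longrightarrow>
       (\<exists>k::int. h = of_int k \<and> even k \<and> k \<ge> 6)) \<and>
    (carmichael_number m \<and> prime g \<and> g dvd m \<longrightarrow>
       (\<exists>k::int. h = of_int k \<and> even k \<and> k \<ge> 6)) \<and>
    (\<forall>n a b. universal_form n a b \<longrightarrow>
       (\<forall>\<nu>\<in>{1..n}. \<forall>t\<ge>0.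
          int m = poly (linear_product n a b) t \<and> int g = a \<nu> * t + b \<nu> \<and> m > g \<and> g > 1 \<longrightarrow>
          (\<exists>k::int. h = of_int k \<and> even k \<and> k \<ge> 4)))"
proof -
  have g: "g \<ge> 2" using assms(1,3) by linarith
  have g1: "real g - 1 > 0" using g by simp
  \<comment> \<open>In this form (h - 2) g (g - 1) = 2 (m - g), which yields both the polygonal
    identity and the criterion for h = 2.\<close>
  have h: "h = 2 * (real m - real g) / (real g * (real g - 1)) + 2"
    using assms(4) g1 g by (simp add: field_simps)
  have "real m / real g > 0" using g assms(2) by simp
  define x where "x = (real m / real g - 1) / (real g - 1)"
  \<comment> \<open>The numerator of \<open>x\<close> exceeds -1, and -1 is at least -(g - 1)
    because g is at least 2.\<close>
  have "x > - 1"
    using \<open>real m / real g > 0\<close> g1 g unfolding x_def by (subst pos_less_divide_eq) auto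
  then have pos: "h > 0" unfolding assms(4) x_def[symmetric] by simp
  have polygonal: "1 / 2 * (real g ^ 2 * (h - 2) - real g * (h - 4)) = real m"
  proof -
    have "(h - 2) * (real g * (real g - 1)) = 2 * (real m - real g)" using h g1 g by simp
    then show ?thesis by (simp add: algebra_simps power2_eq_square)
  qed
  have int: "k \<ge> 1 \<and> real m = polygonal_number k g" if "h = of_int k" for k :: int
    using that pos polygonal by (simp add: polygonal_number_def)
  have eq_g: "m = g \<and> g \<ge> 2 \<longleftrightarrow> h = 2"
    using g g1 by (simp add: h)
  have eq_2: "g = 2 \<longleftrightarrow> h = real m"
  proof
    show "h = real m" if "g = 2" using assms(4) that by simp
  next
    assume "h = real m"
    then have "(real m - 2) * (real g * (real g - 1)) = 2 * (real m - real g)"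
      using h g1 g by (simp add: field_simps)
    \<comment> \<open>The equation is quadratic in \<open>g\<close> with root 2; the cofactor
      remains to be shown nonzero.\<close>
    then have "(real g - 2) * (real m * (real g + 1) - 2 * real g) = 0"
      by (simp add: algebra_simps)
    moreover have "real m * (real g + 1) - 2 * real g \<noteq> 0"
    \<comment> \<open>For m = 1 the cofactor is 1 - g, hence negative; for m \<ge> 2 it is at least
      2(g + 1) - 2g = 2.\<close>
    proof (cases "m = 1")
      case False
      then have "2 * (real g + 1) \<le> real m * (real g + 1)"
        using assms(2) by (intro mult_right_mono) auto
      then show ?thesis by (simp add: algebra_simps)
    qed (use g in auto)
    ultimately show "g = 2" by simp
  qed
  have digit: "\<exists>k::int. h = of_int k \<and> even k \<and> k \<ge> 6" if "g dvd m" "digit_sum g m = g"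
    using h_even_ge_6_digit_sum[OF assms(4) g assms(2)] that by blast
  have decomposition: "\<exists>k::int. h = of_int k \<and> even k \<and> k \<ge> 6"
    if s: "strict_s_decomposition m n \<gamma> e" "\<nu> \<in> {1..n}" "g = \<gamma> \<nu>" for n \<gamma> e \<nu>
  proof (rule digit)
    have "\<gamma> \<nu> dvd \<gamma> \<nu> ^ e \<nu>"
      using s by (intro dvd_power) (force simp: strict_s_decomposition_def)
    also have "\<dots> dvd (\<Prod>\<nu>=1..n. \<gamma> \<nu> ^ e \<nu>)" using s(2) by (intro dvd_prodI) auto
    finally show "g dvd m" using s by (simp add: strict_s_decomposition_def)
    show "digit_sum g m = g" using s by (auto simp: strict_s_decomposition_def)
  qed
  have carmichael: "\<exists>k::int. h = of_int k \<and> even k \<and> k \<ge> 6"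
    if "carmichael_number m" "prime g" "g dvd m"
    \<comment> \<open>The remaining condition \<open>m \<noteq> g\<close> holds because
      \<open>g\<close> is prime and a Carmichael number is not.\<close>
    using h_even_ge_6[OF assms(4) g assms(2) _ carmichael_not_prime_square \<open>g dvd m\<close>
        carmichael_prime_minus_one_dvd] that
    by (auto simp: carmichael_number_def)
  have universal: "\<exists>k::int. h = of_int k \<and> even k \<and> k \<ge> 4"
    if u: "universal_form n a b" "\<nu> \<in> {1..n}" "t \<ge> 0"
      "int m = poly (linear_product n a b) t" "int g = a \<nu> * t + b \<nu>" "m > g"
    for n a b \<nu> t
  proof (rule h_even_ge_4[OF assms(4) g \<open>m > g\<close>])
    have "a \<nu> * t + b \<nu> dvd int m"
      unfolding u(4) poly_linear_product using u(2) by (intro dvd_prodI) auto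
    then show "g dvd m" using u(5) by (metis of_nat_dvd_iff)
    \<comment> \<open>The exceptional case of a universal form would give g = 1, so the congruence
      applies, with modulus g - 1.\<close>
    have "\<not> (t = 0 \<and> b \<nu> = 1)" using u(5) g by auto
    then have "[int m = 1] (mod (int g - 1))"
      using u by (auto simp: universal_form_def)
    then have "int (g - 1) dvd int (m - 1)"
      using g assms(2) by (simp add: cong_iff_dvd_diff of_nat_diff)
    then show "(g - 1) dvd (m - 1)" by (simp only: of_nat_dvd_iff)
  qed
  show ?thesis
    using pos polygonal int eq_g eq_2 h_even_ge_4[OF assms(4)] digit decomposition carmichael
      universal
    by (intro conjI) blast+
qed

end
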